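(* (Lyapunov's inequality.) Let $\mathcal I\subseteq[0,\infty)$ be an interval, let $a,b\in\mathcal I$ with $0\le a<b$, and let $q:\mathcal I\to(0,\infty)$ be continuous and positive-valued. If the conformable equation $$D^{\alpha}D^{\alpha}x(t)+q(t)x(t)=0$$ has a nontrivial solution $x$ with $x(a)=x(b)=0$, then the Lyapunov inequality $$\int_a^b q(t)\,e_0(b,t)\,d_\alpha t\ \ge\ \frac{4\,e_0(b,a)}{h_1(b,a)}$$ holds.
   Context: The functions $\kappa_0,\kappa_1:[0,1]\times\mathcal I\to[0,\infty)$ are continuous and satisfy, for all $t\in\mathcal I$: $\lim_{\alpha\to0^+}\kappa_1(\alpha,t)=1$, $\lim_{\alpha\to0^+}\kappa_0(\alpha,t)=0$, $\lim_{\alpha\to1^-}\kappa_1(\alpha,t)=0$, $\lim_{\alpha\to1^-}\kappa_0(\alpha,t)=1$, $\kappa_1(\alpha,t)\ne0$ for $\alpha\in[0,1)$, and $\kappa_0(\alpha,t)\neq0$ for $\alpha\in(0,1]$. Fix $\alpha\in(0,1]$ and write $\kappa_j(t)=\kappa_j(\alpha,t)$. The conformable (proportional) derivative is $D^{\alpha}f(t)=\kappa_1(t)f(t)+\kappa_0(t)f'(t)$. Write $d_\alpha t=dt/\kappa_0(t)$, $h_1(b,a)=\int_a^b1\,d_\alpha t$, and $e_0(t,s)=\exp\left(-\int_s^t\frac{\kappa_1(\tau)}{\kappa_0(\tau)}\,d\tau\right)$ for $t,s\in\mathcal I$. A solution is a continuous function $x$ on $\mathcal I$ such that $D^{\alpha}x$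 and $D^{\alpha}D^{\alpha}x$ exist and are continuous and the equation holds at all points of $\mathcal I$. *)

theory Defs
  imports "HOL-Analysis.Analysis"
begin

text \<open>
  Throughout, \<open>I\<close> is the time interval. The functions \<open>\<kappa>1 \<kappa>0\<close> depend on
  \<open>\<alpha>\<close> and \<open>t\<close> in the next definition; afterwards \<open>k1 k0\<close> stand for the sections
  \<open>\<kappa>1 \<alpha>\<close> and \<open>\<kappa>0 \<alpha>\<close> at a fixed \<open>\<alpha>\<close>.
\<close>

definition conformable_pair ::
  "real set \<Rightarrow> (real \<Rightarrow> real \<Rightarrow> real) \<Rightarrow> (real \<Rightarrow> real \<Rightarrow> real) \<Rightarrow> bool" where
  "conformable_pair I \<kappa>1 \<kappa>0 \<longleftrightarrow>
     continuous_on ({0..1} \<times> I) (\<lambda>(\<alpha>, t). \<kappa>1 \<alpha> t) \<and>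
     continuous_on ({0..1} \<times> I) (\<lambda>(\<alpha>, t). \<kappa>0 \<alpha> t) \<and>
     (\<forall>\<alpha>\<in>{0..1}. \<forall>t\<in>I. 0 \<le> \<kappa>1 \<alpha> t \<and> 0 \<le> \<kappa>0 \<alpha> t) \<and>
     (\<forall>t\<in>I.
        ((\<lambda>\<alpha>. \<kappa>1 \<alpha> t) \<longlongrightarrow> 1) (at_right 0) \<and>
        ((\<lambda>\<alpha>. \<kappa>0 \<alpha> t) \<longlongrightarrow> 0) (at_right 0) \<and>
        ((\<lambda>\<alpha>. \<kappa>1 \<alpha> t) \<longlongrightarrow> 0) (at_left 1) \<and>
        ((\<lambda>\<alpha>. \<kappa>0 \<alpha> t) \<longlongrightarrow> 1) (at_left 1) \<and>
        (\<forall>\<alpha>\<in>{0..<1}. \<kappa>1 \<alpha> t \<noteq> 0) \<and>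
        (\<forall>\<alpha>\<in>{0<..1}. \<kappa>0 \<alpha> t \<noteq> 0))"

text \<open>
  The derivative is taken within \<open>I\<close>: two-sided at interior points, one-sided at an
  endpoint belonging to \<open>I\<close>. The value is meaningful only where \<open>f\<close> is differentiable
  within \<open>I\<close>, which is what existence of the conformable derivative means.
\<close>

definition conf_deriv ::
  "(real \<Rightarrow> real) \<Rightarrow> (real \<Rightarrow> real) \<Rightarrow> real set \<Rightarrow> (real \<Rightarrow> real) \<Rightarrow> real \<Rightarrow> real" where
  "conf_deriv k1 k0 I f t = k1 t * f t + k0 t * vector_derivative f (at t within I)"

text \<open>The integral with respect to \<open>d\<^sub>\<alpha> t\<close>, oriented from \<open>a\<close> to \<open>b\<close>.\<close>

definition conf_integral :: "(real \<Rightarrow> real) \<Rightarrow> real \<Rightarrow> real \<Rightarrow> (real \<Rightarrow> real) \<Rightarrow> real" where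
  "conf_integral k0 a b f = (LBINT t=a..b. f t / k0 t)"

definition conf_h1 :: "(real \<Rightarrow> real) \<Rightarrow> real \<Rightarrow> real \<Rightarrow> real" where
  "conf_h1 k0 b a = conf_integral k0 a b (\<lambda>_. 1)"

definition conf_exp0 ::
  "(real \<Rightarrow> real) \<Rightarrow> (real \<Rightarrow> real) \<Rightarrow> real \<Rightarrow> real \<Rightarrow> real" where
  "conf_exp0 k1 k0 t s = exp (- (LBINT \<tau>=s..t. k1 \<tau> / k0 \<tau>))"

definition conf_solution ::
  "(real \<Rightarrow> real) \<Rightarrow> (real \<Rightarrow> real) \<Rightarrow> real set \<Rightarrow> (real \<Rightarrow> real) \<Rightarrow> (real \<Rightarrow> real) \<Rightarrow> bool" where
  "conf_solution k1 k0 I q x \<longleftrightarrow>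
     continuous_on I x \<and>
     x differentiable_on I \<and>
     continuous_on I (conf_deriv k1 k0 I x) \<and>
     conf_deriv k1 k0 I x differentiable_on I \<and>
     continuous_on I (conf_deriv k1 k0 I (conf_deriv k1 k0 I x)) \<and>
     (\<forall>t\<in>I. conf_deriv k1 k0 I (conf_deriv k1 k0 I x) t + q t * x t = 0)"

end

theory Submission
  imports Defs
begin

text \<open>
  With \<open>E t = exp (\<integral>\<^sub>a\<^sup>t \<kappa>\<^sub>1/\<kappa>\<^sub>0)\<close>, the functions \<open>y = E x\<close> and \<open>z = E (D x)\<close> solve
  \<open>y' = z / \<kappa>\<^sub>0\<close>, \<open>z' = - q y / \<kappa>\<^sub>0\<close>, which is \<open>y'' + q y = 0\<close> in the time \<open>P = \<integral> 1/\<kappa>\<^sub>0\<close>.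
  Let \<open>M = y c\<close> be the maximum of \<open>y\<close> (up to sign). Mean values of \<open>y\<close> with respect to \<open>P\<close>
  on both sides of \<open>c\<close> show that \<open>z\<close> drops by at least \<open>4 M / (P b - P a)\<close>, while the equation
  for \<open>z\<close> bounds the drop by \<open>M \<integral> q/\<kappa>\<^sub>0\<close>. Finally \<open>q \<le> q E\<close> and \<open>e\<^sub>0(b,t) = e\<^sub>0(b,a) E t\<close>.
  A solution vanishing on \<open>[a,b]\<close> is trivial by Gronwall's argument for \<open>x\<^sup>2 + (D x)\<^sup>2\<close>.
\<close>

section \<open>Monotonicity from one-sided derivatives, and Gronwall's argument\<close>

lemma DERIV_nonneg_within_imp_le:
  fixes f :: "real \<Rightarrow> real"
  assumes "a \<le> b"
    and f: "\<And>t. t \<in> {a..b} \<Longrightarrow> (f has_real_derivative f' t) (at t within {a..b})"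
    and "\<And>t. t \<in> {a..b} \<Longrightarrow> 0 \<le> f' t"
  shows "f a \<le> f b"
proof (rule DERIV_nonneg_imp_increasing_open[OF \<open>a \<le> b\<close>])
  show "continuous_on {a..b} f"
    using f by (meson DERIV_continuous continuous_on_eq_continuous_within)
  fix t assume t: "a < t" "t < b"
  then have "(f has_real_derivative f' t) (at t)"
    using f[of t] by (simp add: at_within_Icc_at)
  then show "\<exists>y. (f has_real_derivative y) (at t) \<and> 0 \<le> y"
    using assms(3)[of t] t by auto
qed

text \<open>A bound \<open>K\<close> for \<open>L\<close> on the segment between \<open>c\<close>
  and \<open>d\<close> makes \<open>u t * exp (- K * t)\<close> nonincreasing and
  \<open>u t * exp (K * t)\<close> nondecreasing there. The first carries the zero at
  \<open>c\<close> forward, the second backward, and nonnegativity of \<open>u\<close> does the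
  rest.\<close>

lemma Gronwall_zero:
  fixes u u' :: "real \<Rightarrow> real"
  assumes "is_interval S" "c \<in> S" "d \<in> S"
    and u: "\<And>t. t \<in> S \<Longrightarrow> (u has_real_derivative u' t) (at t within S)"
    and nonneg: "\<And>t. t \<in> S \<Longrightarrow> 0 \<le> u t"
    and L: "continuous_on S L" "\<And>t. t \<in> S \<Longrightarrow> \<bar>u' t\<bar> \<le> L t * u t"
    and "u c = 0"
  shows "u d = 0"
proof -
  define m where "m = min c d"
  define n where "n = max c d"
  have sub: "{m..n} \<subseteq> S"
    using assms(1-3) unfolding m_def n_def is_interval_1 subset_iff
    by (metis atLeastAtMost_iff max_def min_def)
  have "m \<le> n" by (simp add: m_def n_def)
  \<comment> \<open>\<open>L\<close> may be unbounded on \<open>S\<close>, so a constant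
    \<open>K\<close> is available only on the compact segment.\<close>
  have "compact (L ` {m..n})"
    using L(1) sub by (intro compact_continuous_image) (auto intro: continuous_on_subset)
  then obtain K where K: "\<And>t. t \<in> {m..n} \<Longrightarrow> L t \<le> K"
    by (metis bdd_above_def bounded_imp_bdd_above compact_imp_bounded image_eqI)
  have u1: "(u has_real_derivative u' t) (at t within {m..n})" if "t \<in> {m..n}" for t
    using u sub that by (meson DERIV_subset subsetD)
  have b: "\<bar>u' t\<bar> \<le> K * u t" if "t \<in> {m..n}" for t
    using L(2)[of t] mult_right_mono[OF K[OF that] nonneg[of t]] sub that by force
  have "u d \<le> 0"
  proof (cases "c \<le> d")
    case True
    then have mn: "m = c" "n = d" by (auto simp: m_def n_def)
    \<comment> \<open>The minus sign turns the decreasing function into an increasing one, as the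
      monotonicity lemma requires.\<close>
    have "- (u m * exp (- K * m)) \<le> - (u n * exp (- K * n))"
    proof (rule DERIV_nonneg_within_imp_le[OF \<open>m \<le> n\<close>])
      fix t assume t: "t \<in> {m..n}"
      show "((\<lambda>t. - (u t * exp (- K * t))) has_real_derivative (K * u t - u' t) * exp (- K * t))
          (at t within {m..n})"
        by (rule derivative_eq_intros u1[OF t] refl | simp add: algebra_simps)+
      show "0 \<le> (K * u t - u' t) * exp (- K * t)" using b[OF t] by simp
    qed
    then show ?thesis using \<open>u c = 0\<close> by (simp add: mn mult_le_0_iff)
  next
    case False
    then have mn: "m = d" "n = c" by (auto simp: m_def n_def)
    have "u m * exp (K * m) \<le> u n * exp (K * n)"
    proof (rule DERIV_nonneg_within_imp_le[OF \<open>m \<le> n\<close>])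
      fix t assume t: "t \<in> {m..n}"
      show "((\<lambda>t. u t * exp (K * t)) has_real_derivative (K * u t + u' t) * exp (K * t))
          (at t within {m..n})"
        by (rule derivative_eq_intros u1[OF t] refl | simp add: algebra_simps)+
      show "0 \<le> (K * u t + u' t) * exp (K * t)" using b[OF t] by simp
    qed
    then show ?thesis using \<open>u c = 0\<close> by (simp add: mn mult_le_0_iff)
  qed
  then show ?thesis using nonneg[OF \<open>d \<in> S\<close>] by simp
qed

section \<open>The Lyapunov inequality for a first-order system\<close>

lemma Cauchy_mean_value_quotient:
  fixes y P z p :: "real \<Rightarrow> real"
  assumes "a < b"
    and y: "\<And>t. t \<in> {a..b} \<Longrightarrow> (y has_real_derivative p t * z t) (at t within {a..b})"
    and P: "\<And>t. t \<in> {a..b} \<Longrightarrow> (P has_real_derivative p t) (at t within {a..b})"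
    and pos: "\<And>t. t \<in> {a..b} \<Longrightarrow> 0 < p t"
  obtains \<xi> where "a < \<xi>" "\<xi> < b" "y b - y a = z \<xi> * (P b - P a)"
proof -
  \<comment> \<open>The combination takes equal values at \<open>a\<close> and \<open>b\<close>, and
    its derivative contains the factor \<open>p\<close>, which is positive and cancels.\<close>
  define h where "h = (\<lambda>t. (P b - P a) * y t - (y b - y a) * P t)"
  have h: "(h has_real_derivative p t * ((P b - P a) * z t - (y b - y a))) (at t within {a..b})"
    if "t \<in> {a..b}" for t
    unfolding h_def
    by (rule derivative_eq_intros y[OF that] P[OF that] refl | simp add: algebra_simps)+
  have cont: "continuous_on {a..b} h"
    using h by (meson DERIV_continuous continuous_on_eq_continuous_within)
  have deriv: "(h has_derivative (*) (p t * ((P b - P a) * z t - (y b - y a)))) (at t)"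
    if "a < t" "t < b" for t
    using h[of t] that by (simp add: at_within_Icc_at has_field_derivative_def)
  obtain \<xi> where \<xi>: "a < \<xi>" "\<xi> < b"
    "h b - h a = p \<xi> * ((P b - P a) * z \<xi> - (y b - y a)) * (b - a)"
    using mvt[OF \<open>a < b\<close> cont deriv] by blast
  have "h b - h a = 0" by (simp add: h_def algebra_simps)
  then have "(P b - P a) * z \<xi> - (y b - y a) = 0"
    using \<xi> pos[of \<xi>] \<open>a < b\<close> by simp
  then show ?thesis using that \<xi> by (simp add: mult.commute)
qed

text \<open>Integrals enter only through their primitives \<open>P\<close> and \<open>Q\<close>. The
  majorant \<open>w\<close> of \<open>q\<close> leaves room for the exponential weight in the
  conformable inequality.\<close>

lemma Lyapunov_system_pos:
  fixes y z P Q p q :: "real \<Rightarrow> real"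
  assumes "a < b"
    and y: "\<And>t. t \<in> {a..b} \<Longrightarrow> (y has_real_derivative p t * z t) (at t within {a..b})"
    and z: "\<And>t. t \<in> {a..b} \<Longrightarrow> (z has_real_derivative - (q t * y t)) (at t within {a..b})"
    and P: "\<And>t. t \<in> {a..b} \<Longrightarrow> (P has_real_derivative p t) (at t within {a..b})"
    and Q: "\<And>t. t \<in> {a..b} \<Longrightarrow> (Q has_real_derivative w t) (at t within {a..b})"
    and p: "\<And>t. t \<in> {a..b} \<Longrightarrow> 0 < p t"
    and q: "\<And>t. t \<in> {a..b} \<Longrightarrow> 0 \<le> q t"
    and w: "\<And>t. t \<in> {a..b} \<Longrightarrow> q t \<le> w t"
    and "y a = 0" "y b = 0"
    and c: "c \<in> {a..b}" "0 < y c" "\<And>t. t \<in> {a..b} \<Longrightarrow> y t \<le> y c"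
  shows "4 \<le> (P b - P a) * (Q b - Q a)"
proof -
  have ac: "a < c" "c < b" using c \<open>y a = 0\<close> \<open>y b = 0\<close> by (auto simp: less_le)
  obtain r where r: "a < r" "r < c" "y c - y a = z r * (P c - P a)"
  proof (rule Cauchy_mean_value_quotient[OF ac(1), of y p z P])
    show "(y has_real_derivative p t * z t) (at t within {a..c})" if "t \<in> {a..c}" for t
      using y[of t] that ac by (auto intro: DERIV_subset)
    show "(P has_real_derivative p t) (at t within {a..c})" if "t \<in> {a..c}" for t
      using P[of t] that ac by (auto intro: DERIV_subset)
  qed (use p ac in auto)
  obtain s where s: "c < s" "s < b" "y b - y c = z s * (P b - P c)"
  proof (rule Cauchy_mean_value_quotient[OF ac(2), of y p z P])
    show "(y has_real_derivative p t * z t) (at t within {c..b})" if "t \<in> {c..b}" for t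
      using y[of t] that ac by (auto intro: DERIV_subset)
    show "(P has_real_derivative p t) (at t within {c..b})" if "t \<in> {c..b}" for t
      using P[of t] that ac by (auto intro: DERIV_subset)
  qed (use p ac in auto)
  have Qmono: "Q m \<le> Q n" if "a \<le> m" "m \<le> n" "n \<le> b" for m n
  proof (rule DERIV_nonneg_within_imp_le[OF \<open>m \<le> n\<close>])
    show "(Q has_real_derivative w t) (at t within {m..n})" if "t \<in> {m..n}" for t
      using Q[of t] that \<open>a \<le> m\<close> \<open>n \<le> b\<close> by (auto intro: DERIV_subset)
    show "0 \<le> w t" if "t \<in> {m..n}" for t
      using q[of t] w[of t] that \<open>a \<le> m\<close> \<open>n \<le> b\<close> by auto
  qed
  have Pmono: "P m \<le> P n" if "a \<le> m" "m \<le> n" "n \<le> b" for m n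
  proof (rule DERIV_nonneg_within_imp_le[OF \<open>m \<le> n\<close>])
    show "(P has_real_derivative p t) (at t within {m..n})" if "t \<in> {m..n}" for t
      using P[of t] that \<open>a \<le> m\<close> \<open>n \<le> b\<close> by (auto intro: DERIV_subset)
    show "0 \<le> p t" if "t \<in> {m..n}" for t
      using p[of t] that \<open>a \<le> m\<close> \<open>n \<le> b\<close> by auto
  qed
  \<comment> \<open>The drop of \<open>z\<close> is compared with the growth of \<open>Q\<close>
    through a single monotone function. Its derivative is nonnegative since
    \<open>q t * y t \<le> q t * y c \<le> w t * y c\<close>.\<close>
  have "y c * Q r + z r \<le> y c * Q s + z s"
  proof (rule DERIV_nonneg_within_imp_le[where a = r and b = s and f = "\<lambda>t. y c * Q t + z t"])
    show "r \<le> s" using r s by simp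
    fix t assume "t \<in> {r..s}"
    then have t: "t \<in> {a..b}" "{r..s} \<subseteq> {a..b}" using r s by auto
    show "((\<lambda>t. y c * Q t + z t) has_real_derivative y c * w t - q t * y t) (at t within {r..s})"
      by (rule derivative_eq_intros DERIV_subset[OF Q[OF t(1)] t(2)]
          DERIV_subset[OF z[OF t(1)] t(2)] refl | simp)+
    have "q t * y t \<le> w t * y c"
      using q[OF t(1)] w[OF t(1)] c(2) c(3)[OF t(1)]
      by (meson less_imp_le mult_left_mono mult_right_mono order_trans)
    then show "0 \<le> y c * w t - q t * y t" by (simp add: mult.commute)
  qed
  then have drop: "z r - z s \<le> y c * (Q s - Q r)" by (simp add: algebra_simps)
  also have "\<dots> \<le> y c * (Q b - Q a)"
    using Qmono[of a r] Qmono[of s b] r s c(2) ac by (intro mult_left_mono) auto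
  finally have zle: "z r - z s \<le> y c * (Q b - Q a)" .
  define A where "A = P c - P a"
  define B where "B = P b - P c"
  have yA: "y c = z r * A" and yB: "y c = - z s * B"
    using r(3) s(3) \<open>y a = 0\<close> \<open>y b = 0\<close> by (simp_all add: A_def B_def)
  \<comment> \<open>Monotonicity of \<open>P\<close> gives only weak inequalities; strictness
    follows since \<open>y c > 0\<close> is a multiple of both \<open>A\<close> and
    \<open>B\<close>.\<close>
  have pos: "0 < A" "0 < B"
    using Pmono[of a c] Pmono[of c b] ac yA yB c(2) by (auto simp: A_def B_def less_le)
  \<comment> \<open>The constant 4 comes from \<open>(A + B) * (1 / A + 1 / B) \<ge> 4\<close>,
    whose defect is \<open>(A - B)\<^sup>2 / (A * B)\<close>.\<close>
  have "4 * y c \<le> (A + B) * (z r - z s)"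
  proof -
    have "z r = y c / A" "- z s = y c / B" using yA yB pos by (auto simp: field_simps)
    then have diff: "z r - z s = y c / A + y c / B" by simp
    have "(A + B) * (z r - z s) - 4 * y c = y c * (A - B)\<^sup>2 / (A * B)"
      unfolding diff using pos by (simp add: field_simps power2_eq_square)
    moreover have "0 \<le> y c * (A - B)\<^sup>2 / (A * B)" using pos c(2) by simp
    ultimately show ?thesis by linarith
  qed
  also have "\<dots> \<le> (A + B) * (y c * (Q b - Q a))"
    using zle pos by (intro mult_left_mono) auto
  also have "A + B = P b - P a" by (simp add: A_def B_def)
  finally have "y c * 4 \<le> y c * ((P b - P a) * (Q b - Q a))" by (simp add: mult_ac)
  then show ?thesis using c(2) by simp
qed

text \<open>The system is linear, so \<open>(- y, - z)\<close> solves it too; at a maximum point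
  \<open>c\<close> of the absolute value of \<open>y\<close>, one of the two signs makes the value
  at \<open>c\<close> a positive maximum.\<close>

lemma Lyapunov_system:
  fixes y z P Q p q :: "real \<Rightarrow> real"
  assumes "a < b"
    and y: "\<And>t. t \<in> {a..b} \<Longrightarrow> (y has_real_derivative p t * z t) (at t within {a..b})"
    and z: "\<And>t. t \<in> {a..b} \<Longrightarrow> (z has_real_derivative - (q t * y t)) (at t within {a..b})"
    and P: "\<And>t. t \<in> {a..b} \<Longrightarrow> (P has_real_derivative p t) (at t within {a..b})"
    and Q: "\<And>t. t \<in> {a..b} \<Longrightarrow> (Q has_real_derivative w t) (at t within {a..b})"
    and p: "\<And>t. t \<in> {a..b} \<Longrightarrow> 0 < p t"
    and q: "\<And>t. t \<in> {a..b} \<Longrightarrow> 0 \<le> q t"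
    and w: "\<And>t. t \<in> {a..b} \<Longrightarrow> q t \<le> w t"
    and ya: "y a = 0" and yb: "y b = 0"
    and nontriv: "\<exists>t\<in>{a..b}. y t \<noteq> 0"
  shows "4 \<le> (P b - P a) * (Q b - Q a)"
proof -
  have "continuous_on {a..b} (\<lambda>t. \<bar>y t\<bar>)"
    using y by (intro continuous_on_rabs)
      (meson DERIV_continuous continuous_on_eq_continuous_within)
  then obtain c where c: "c \<in> {a..b}" "\<And>t. t \<in> {a..b} \<Longrightarrow> \<bar>y t\<bar> \<le> \<bar>y c\<bar>"
    using continuous_attains_sup[of "{a..b}" "\<lambda>t. \<bar>y t\<bar>"] \<open>a < b\<close> by auto
  have "y c \<noteq> 0" using c(2) nontriv by force
  show ?thesis
  proof (cases "0 < y c")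
    case True
    show ?thesis
      by (rule Lyapunov_system_pos[OF \<open>a < b\<close> y z P Q p q w ya yb c(1) True])
        (use c(2) True in \<open>auto dest: abs_le_D1\<close>)
  next
    case False
    show ?thesis
    proof (rule Lyapunov_system_pos[OF \<open>a < b\<close> _ _ P Q p q w _ _ c(1),
          where y = "\<lambda>t. - y t" and z = "\<lambda>t. - z t"])
      fix t assume t: "t \<in> {a..b}"
      show "((\<lambda>t. - y t) has_real_derivative p t * - z t) (at t within {a..b})"
        using DERIV_minus[OF y[OF t]] by simp
      show "((\<lambda>t. - z t) has_real_derivative - (q t * - y t)) (at t within {a..b})"
        using DERIV_minus[OF z[OF t]] by simp
      show "- y t \<le> - y c" using c(2)[OF t] False by linarith
    qed (use ya yb False \<open>y c \<noteq> 0\<close> in auto)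
  qed
qed

section \<open>The conformable equation as a first-order linear system\<close>

lemma conformable_pair_continuous_on:
  assumes "conformable_pair I \<kappa>1 \<kappa>0" "\<alpha> \<in> {0..1}"
  shows "continuous_on I (\<kappa>1 \<alpha>)" "continuous_on I (\<kappa>0 \<alpha>)"
proof -
  have im: "Pair \<alpha> ` I \<subseteq> {0..1} \<times> I" using assms(2) by auto
  have pair: "continuous_on I (Pair \<alpha>)" by (intro continuous_intros)
  show "continuous_on I (\<kappa>1 \<alpha>)" "continuous_on I (\<kappa>0 \<alpha>)"
    using assms(1) continuous_on_compose2[OF _ pair im] unfolding conformable_pair_def
    by fastforce+
qed

lemma conf_deriv_imp_has_real_derivative:
  assumes "f differentiable_on I" "t \<in> I" "k0 t \<noteq> 0"
  shows "(f has_real_derivative (conf_deriv k1 k0 I f t - k1 t * f t) / k0 t) (at t within I)"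
proof -
  have "f differentiable (at t within I)" using assms(1,2) by (auto simp: differentiable_on_def)
  then have "(f has_vector_derivative vector_derivative f (at t within I)) (at t within I)"
    by (simp add: vector_derivative_works)
  then show ?thesis
    using assms(3) by (simp add: conf_deriv_def has_real_derivative_iff_has_vector_derivative)
qed

text \<open>Solving both conformable derivatives for the ordinary ones gives a system in
  \<open>x\<close> and \<open>v\<close>. This avoids a second derivative of \<open>x\<close>, which
  need not exist when \<open>k0\<close> is merely continuous.\<close>

lemma conf_solution_system:
  assumes "conf_solution k1 k0 I q x" "t \<in> I" "k0 t \<noteq> 0"
  defines "v \<equiv> conf_deriv k1 k0 I x"
  shows "(x has_real_derivative (v t - k1 t * x t) / k0 t) (at t within I)"
    and "(v has_real_derivative (- (q t * x t) - k1 t * v t) / k0 t) (at t within I)"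
proof -
  show "(x has_real_derivative (v t - k1 t * x t) / k0 t) (at t within I)"
    unfolding v_def using assms(1-3)
    by (intro conf_deriv_imp_has_real_derivative) (auto simp: conf_solution_def)
  have "conf_deriv k1 k0 I v t = - (q t * x t)"
    using assms(1,2) by (simp add: conf_solution_def v_def eq_neg_iff_add_eq_0)
  moreover have "v differentiable_on I" using assms(1) by (simp add: conf_solution_def v_def)
  ultimately show "(v has_real_derivative (- (q t * x t) - k1 t * v t) / k0 t) (at t within I)"
    using conf_deriv_imp_has_real_derivative[of v I t k0 k1, OF _ assms(2,3)] by metis
qed

text \<open>Nontriviality is known only on \<open>I\<close>, whereas the maximum argument needs a
  nonzero value on \<open>{a..b}\<close>. If there were none, \<open>x\<close> and \<open>v\<close>
  would both vanish at an interior point, and uniqueness for the linear system would make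
  \<open>x\<close> zero on all of \<open>I\<close>.\<close>

lemma conf_solution_nontrivial_on_segment:
  assumes "is_interval I" "{a..b} \<subseteq> I" "a < b"
    and cont: "continuous_on I k1" "continuous_on I k0" "continuous_on I q"
    and sgn: "\<And>t. t \<in> I \<Longrightarrow> 0 \<le> k1 t" "\<And>t. t \<in> I \<Longrightarrow> 0 < k0 t" "\<And>t. t \<in> I \<Longrightarrow> 0 < q t"
    and sol: "conf_solution k1 k0 I q x"
    and "\<exists>t\<in>I. x t \<noteq> 0"
  shows "\<exists>t\<in>{a..b}. x t \<noteq> 0"
proof (rule ccontr)
  assume "\<not> (\<exists>t\<in>{a..b}. x t \<noteq> 0)"
  then have zero: "\<And>t. t \<in> {a..b} \<Longrightarrow> x t = 0" by blast
  define v where "v = conf_deriv k1 k0 I x"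
  have k0: "k0 t \<noteq> 0" if "t \<in> I" for t using sgn(2)[OF that] by simp
  have x': "(x has_real_derivative (v t - k1 t * x t) / k0 t) (at t within I)"
    and v': "(v has_real_derivative (- (q t * x t) - k1 t * v t) / k0 t) (at t within I)"
    if "t \<in> I" for t
    unfolding v_def using conf_solution_system[OF sol that k0[OF that]] by blast+
  \<comment> \<open>At an interior point \<open>x\<close> vanishes in a neighbourhood, so its
    derivative there is zero and \<open>v c = 0\<close> follows.\<close>
  define c where "c = (a + b) / 2"
  have c: "a < c" "c < b" using \<open>a < b\<close> by (auto simp: c_def)
  then have "c \<in> I" "x c = 0" using assms(2) zero by auto
  have "v c = 0"
  proof -
    have "(x has_real_derivative (v c - k1 c * x c) / k0 c) (at c within {a..b})"
      using x'[OF \<open>c \<in> I\<close>] assms(2) by (rule DERIV_subset)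
    then have "(x has_real_derivative (v c - k1 c * x c) / k0 c) (at c)"
      using c by (simp add: at_within_Icc_at)
    moreover have "(x has_real_derivative 0) (at c)"
      by (rule has_field_derivative_transform_within_open[where f = "\<lambda>_. 0" and S = "{a<..<b}"])
        (use c zero in auto)
    ultimately have "(v c - k1 c * x c) / k0 c = 0" by (rule DERIV_unique)
    then show ?thesis using \<open>x c = 0\<close> k0[OF \<open>c \<in> I\<close>] by simp
  qed
  have "x d = 0" if "d \<in> I" for d
  proof -
    have "(x d)\<^sup>2 + (v d)\<^sup>2 = 0"
    proof (rule Gronwall_zero[OF \<open>is_interval I\<close> \<open>c \<in> I\<close> \<open>d \<in> I\<close>])
      fix t assume t: "t \<in> I"
      show "((\<lambda>t. (x t)\<^sup>2 + (v t)\<^sup>2) has_real_derivative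
          2 * ((1 - q t) * (x t * v t) - k1 t * ((x t)\<^sup>2 + (v t)\<^sup>2)) / k0 t) (at t within I)"
        by (rule derivative_eq_intros x'[OF t] v'[OF t] refl
            | use k0[OF t] in \<open>simp add: field_simps power2_eq_square\<close>)+
      define u where "u = (x t)\<^sup>2 + (v t)\<^sup>2"
      \<comment> \<open>With \<open>\<bar>1 - q t\<bar> \<le> 1 + q t\<close>, this bounds the mixed
        term by a multiple of \<open>u\<close> and yields the Gronwall coefficient
        \<open>(1 + q t + 2 * k1 t) / k0 t\<close>.\<close>
      have xv: "2 * \<bar>x t * v t\<bar> \<le> u"
        using sum_squares_bound[of "\<bar>x t\<bar>" "\<bar>v t\<bar>"] by (simp add: u_def abs_mult)
      have "0 \<le> u" by (simp add: u_def)
      have "\<bar>2 * ((1 - q t) * (x t * v t) - k1 t * u)\<bar>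
          \<le> \<bar>1 - q t\<bar> * (2 * \<bar>x t * v t\<bar>) + 2 * k1 t * u"
      proof -
        have "0 \<le> 2 * k1 t * u" using sgn(1)[OF t] \<open>0 \<le> u\<close> by simp
        moreover have "\<bar>1 - q t\<bar> * (2 * \<bar>x t * v t\<bar>) = \<bar>2 * ((1 - q t) * (x t * v t))\<bar>"
          by (simp add: abs_mult)
        ultimately show ?thesis by (simp only: right_diff_distrib)
      qed
      also have "\<dots> \<le> (1 + q t) * u + 2 * k1 t * u"
        using sgn(3)[OF t] xv by (intro add_mono mult_mono order_refl) auto
      finally show "\<bar>2 * ((1 - q t) * (x t * v t) - k1 t * ((x t)\<^sup>2 + (v t)\<^sup>2)) / k0 t\<bar>
          \<le> (1 + q t + 2 * k1 t) / k0 t * ((x t)\<^sup>2 + (v t)\<^sup>2)"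
        using sgn(2)[OF t] by (simp add: u_def abs_divide divide_right_mono distrib_right)
    next
      show "continuous_on I (\<lambda>t. (1 + q t + 2 * k1 t) / k0 t)"
        using cont k0 by (intro continuous_intros) auto
    qed (use \<open>x c = 0\<close> \<open>v c = 0\<close> in auto)
    then show ?thesis by (simp add: sum_power2_eq_zero_iff)
  qed
  then show False using assms by blast
qed

section \<open>From the system back to the conformable inequality\<close>

theorem theorem9p3:
  fixes I :: "real set"
    and \<kappa>1 \<kappa>0 :: "real \<Rightarrow> real \<Rightarrow> real"
    and \<alpha> a b :: real
    and q x :: "real \<Rightarrow> real"
  assumes "is_interval I" and "I \<subseteq> {0..}"
    and "conformable_pair I \<kappa>1 \<kappa>0"
    and "\<alpha> \<in> {0<..1}"
    and "a \<in> I" and "b \<in> I" and "0 \<le> a" and "a < b"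
    and "continuous_on I q" and "\<And>t. t \<in> I \<Longrightarrow> 0 < q t"
    and "conf_solution (\<kappa>1 \<alpha>) (\<kappa>0 \<alpha>) I q x"
    and "\<exists>t\<in>I. x t \<noteq> 0"
    and "x a = 0" and "x b = 0"
  shows "conf_integral (\<kappa>0 \<alpha>) a b (\<lambda>t. q t * conf_exp0 (\<kappa>1 \<alpha>) (\<kappa>0 \<alpha>) b t)
           \<ge> 4 * conf_exp0 (\<kappa>1 \<alpha>) (\<kappa>0 \<alpha>) b a / conf_h1 (\<kappa>0 \<alpha>) b a"
proof -
  define k1 where "k1 = \<kappa>1 \<alpha>"
  define k0 where "k0 = \<kappa>0 \<alpha>"
  have ab: "{a..b} \<subseteq> I"
    using assms(1,5,6) unfolding is_interval_1 subset_iff by (meson atLeastAtMost_iff)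
  have cont: "continuous_on I k1" "continuous_on I k0"
    using conformable_pair_continuous_on[OF assms(3)] assms(4) by (auto simp: k1_def k0_def)
  have k1: "0 \<le> k1 t" and k0: "0 < k0 t" if "t \<in> I" for t
    using assms(3,4) that unfolding conformable_pair_def k1_def k0_def
    by (auto simp: less_le)
  have k0_nz: "k0 t \<noteq> 0" if "t \<in> I" for t using k0[OF that] by simp
  have sol: "conf_solution k1 k0 I q x" using assms(11) by (simp add: k1_def k0_def)
  \<comment> \<open>All primitives start at \<open>a\<close> and vanish there;
    \<open>exp (F t)\<close> is the integrating factor, \<open>P b\<close> is
    \<open>h_1(b,a)\<close>, and \<open>G b\<close> is the left-hand side of the claim.\<close>
  define F where "F = (\<lambda>t::real. LBINT s=a..t. k1 s / k0 s)"
  define P where "P = (\<lambda>t::real. LBINT s=a..t. 1 / k0 s)"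
  define W where "W = (\<lambda>t. q t * conf_exp0 k1 k0 b t / k0 t)"
  define G where "G = (\<lambda>t::real. LBINT s=a..t. W s)"
  have FTC: "((\<lambda>u::real. LBINT s=a..u. f s) has_real_derivative f t) (at t within {a..b})"
    if "continuous_on {a..b} f" "t \<in> {a..b}" for f :: "real \<Rightarrow> real" and t
    using interval_integral_FTC2[of a a b f t] that \<open>a < b\<close>
    by (simp add: has_real_derivative_iff_has_vector_derivative)
  have contF: "continuous_on {a..b} (\<lambda>t. k1 t / k0 t)"
    using cont ab k0_nz by (intro continuous_intros) (auto intro: continuous_on_subset)
  have F': "(F has_real_derivative k1 t / k0 t) (at t within {a..b})" if "t \<in> {a..b}" for t
    unfolding F_def by (rule FTC[OF contF that])
  have P': "(P has_real_derivative 1 / k0 t) (at t within {a..b})" if "t \<in> {a..b}" for t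
    unfolding P_def using cont ab k0_nz that
    by (intro FTC continuous_intros) (auto intro: continuous_on_subset)
  have F_nonneg: "0 \<le> F t" if "t \<in> {a..b}" for t
  proof -
    have "F a \<le> F t"
    proof (rule DERIV_nonneg_within_imp_le[where a = a and b = t and f = F])
      show "a \<le> t" using that by simp
      fix s assume s: "s \<in> {a..t}"
      then have "s \<in> {a..b}" "s \<in> I" using that ab by auto
      then show "(F has_real_derivative k1 s / k0 s) (at s within {a..t})" "0 \<le> k1 s / k0 s"
        using F'[of s] that k1[of s] k0[of s] by (auto intro: DERIV_subset)
    qed
    then show ?thesis by (simp add: F_def)
  qed
  have exp0: "conf_exp0 k1 k0 b t = exp (F t - F b)" if "t \<in> {a..b}" for t
  proof -
    have "(LBINT s=a..t. k1 s / k0 s) + (LBINT s=t..b. k1 s / k0 s) = (LBINT s=a..b. k1 s / k0 s)"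
      using that \<open>a < b\<close> contF interval_integrable_continuous_on[of a b "\<lambda>t. k1 t / k0 t"]
      by (intro interval_integral_sum) (simp add: min_def max_def)
    then have "F t - F b = - (LBINT s=t..b. k1 s / k0 s)" by (simp add: F_def)
    then show ?thesis by (simp add: conf_exp0_def)
  qed
  \<comment> \<open>In \<open>W\<close> the variable is a limit of integration; rewriting by
    \<open>exp0\<close> reduces continuity to that of \<open>F\<close>.\<close>
  have contW: "continuous_on {a..b} W"
  proof -
    have "continuous_on {a..b} F"
      using F' by (meson DERIV_continuous continuous_on_eq_continuous_within)
    then have "continuous_on {a..b} (\<lambda>t. q t * exp (F t - F b) / k0 t)"
      using cont ab k0_nz assms(9) by (intro continuous_intros) (auto intro: continuous_on_subset)
    then show ?thesis by (rule continuous_on_eq) (simp add: W_def exp0)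
  qed
  have G': "(G has_real_derivative W t) (at t within {a..b})" if "t \<in> {a..b}" for t
    unfolding G_def by (rule FTC[OF contW that])
  define v where "v = conf_deriv k1 k0 I x"
  have x': "(x has_real_derivative (v t - k1 t * x t) / k0 t) (at t within {a..b})"
    and v': "(v has_real_derivative (- (q t * x t) - k1 t * v t) / k0 t) (at t within {a..b})"
    if "t \<in> {a..b}" for t
    using conf_solution_system[OF sol _ k0_nz, of t] that ab unfolding v_def
    by (blast intro: DERIV_subset)+
  \<comment> \<open>The factor \<open>exp (F b)\<close> is the reciprocal of
    \<open>e_0(b,a)\<close>. It turns the weight \<open>W t\<close> into
    \<open>q t * exp (F t) / k0 t\<close>, which dominates \<open>q t / k0 t\<close> because
    \<open>F\<close> is nonnegative.\<close>
  have "4 \<le> (P b - P a) * (exp (F b) * G b - exp (F b) * G a)"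
  proof (rule Lyapunov_system[OF \<open>a < b\<close>, where y = "\<lambda>t. exp (F t) * x t"
        and z = "\<lambda>t. exp (F t) * v t" and p = "\<lambda>t. 1 / k0 t" and q = "\<lambda>t. q t / k0 t"
        and P = P and Q = "\<lambda>t. exp (F b) * G t" and w = "\<lambda>t. exp (F b) * W t"])
    fix t assume t: "t \<in> {a..b}"
    then have "t \<in> I" using ab by auto
    note nz = k0_nz[OF \<open>t \<in> I\<close>] and pos = k0[OF \<open>t \<in> I\<close>] assms(10)[OF \<open>t \<in> I\<close>]
    \<comment> \<open>Differentiating \<open>exp (F t)\<close> produces exactly the
      \<open>k1\<close> term that cancels the one in the equation for \<open>x\<close>; the same
      happens for \<open>v\<close>.\<close>
    show "((\<lambda>t. exp (F t) * x t) has_real_derivative 1 / k0 t * (exp (F t) * v t))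
        (at t within {a..b})"
      by (rule derivative_eq_intros F'[OF t] x'[OF t] refl
          | use nz in \<open>simp add: field_simps\<close>)+
    show "((\<lambda>t. exp (F t) * v t) has_real_derivative - (q t / k0 t * (exp (F t) * x t)))
        (at t within {a..b})"
      by (rule derivative_eq_intros F'[OF t] v'[OF t] refl
          | use nz in \<open>simp add: field_simps\<close>)+
    show "(P has_real_derivative 1 / k0 t) (at t within {a..b})" by (rule P'[OF t])
    show "((\<lambda>t. exp (F b) * G t) has_real_derivative exp (F b) * W t) (at t within {a..b})"
      by (rule DERIV_cmult[OF G'[OF t]])
    show "0 < 1 / k0 t" "0 \<le> q t / k0 t" using pos by auto
    have "exp (F b) * W t = q t / k0 t * exp (F t)"
      by (simp add: W_def exp0[OF t] exp_diff)
    moreover have "1 \<le> exp (F t)" using F_nonneg[OF t] by simp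
    ultimately show "q t / k0 t \<le> exp (F b) * W t"
      using pos mult_left_mono[of 1 "exp (F t)" "q t / k0 t"] by simp
  next
    show "\<exists>t\<in>{a..b}. exp (F t) * x t \<noteq> 0"
      using conf_solution_nontrivial_on_segment[OF assms(1) ab \<open>a < b\<close> cont assms(9) k1 k0 _ sol]
        assms(10,12) by simp
  qed (use assms in auto)
  moreover have "P a = 0" "G a = 0" by (simp_all add: P_def G_def)
  ultimately have main: "4 \<le> P b * (exp (F b) * G b)" by simp
  have "0 \<le> P b"
  proof -
    have "P a \<le> P b"
      using \<open>a < b\<close> P' ab k0 by (intro DERIV_nonneg_within_imp_le[of a b P "\<lambda>t. 1 / k0 t"])
        (auto simp: less_imp_le subset_iff)
    then show ?thesis using \<open>P a = 0\<close> by simp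
  qed
  \<comment> \<open>\<open>P b = 0\<close> would contradict \<open>main\<close>, whose product is at
    least 4.\<close>
  then have "0 < P b" using main by (auto simp: less_le)
  then have "4 * exp (- F b) / P b \<le> G b"
    using main by (simp add: exp_minus field_simps)
  moreover have "conf_exp0 k1 k0 b a = exp (- F b)"
    using exp0[of a] \<open>a < b\<close> by (simp add: F_def)
  moreover have "conf_h1 k0 b a = P b" by (simp add: conf_h1_def conf_integral_def P_def)
  moreover have "conf_integral k0 a b (\<lambda>t. q t * conf_exp0 k1 k0 b t) = G b"
    by (simp add: conf_integral_def G_def W_def)
  ultimately show ?thesis by (simp add: k1_def k0_def)
qed

end
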